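(* Let $m\ge3$. Let $\pi$ be a permutation of $\mathbb{F}_2^m$ with the property that $D_vD_w\pi\neq0_m$ (i.e., $D_vD_w\pi$ is not identically zero) for all linearly independent $v,w\in\mathbb{F}_2^m$, and let $q\colon\mathbb{F}_2^{2m}\to\mathbb{F}_2$ be defined by $q(x,y)=x\cdot\pi(y)$, $x,y\in\mathbb{F}_2^m$. Let $A$ be any linear permutation of $\mathbb{F}_2^{2m}$ which fixes some $(m-1)$-dimensional subspace $U$ of $\mathbb{F}_2^m\times\{0_m\}$ (that is, $A(U)=U$), but does not fix the whole subspace $\mathbb{F}_2^m\times\{0_m\}$ (that is, $A(\mathbb{F}_2^m\times\{0_m\})\neq\mathbb{F}_2^m\times\{0_m\}$). Let $g\colon\mathbb{F}_2^{2m}\to\mathbb{F}_2$ be defined by $g=q\circ A$. Then the function $f\colon\mathbb{F}_2^{2m+2}\to\mathbb{F}_2$ defined by $f=q||g||q||(g+1)$ is a bent function outside $\mathcal{M}^{\#}$.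
   Context: "$\cdot$" is the standard dot product over $\mathbb{F}_2$; $0_m$ is the zero vector of $\mathbb{F}_2^m$. For a map $\pi$ on $\mathbb{F}_2^m$, $D_vD_w\pi(y)=\pi(y)+\pi(y+v)+\pi(y+w)+\pi(y+v+w)$. For $f\colon\mathbb{F}_2^n\to\mathbb{F}_2$, $W_f(\omega)=\sum_{x\in\mathbb{F}_2^n}(-1)^{f(x)+\omega\cdot x}$. For $n$ even, $f$ is bent if $W_f(\omega)=\pm2^{n/2}$ for all $\omega\in\mathbb{F}_2^n$. The concatenation $f=f_1||f_2||f_3||f_4$ of Boolean functions $f_i$ on $\mathbb{F}_2^n$ is the function on $\mathbb{F}_2^{n+2}$ with $f(z,0,0)=f_1(z)$, $f(z,0,1)=f_2(z)$, $f(z,1,0)=f_3(z)$, $f(z,1,1)=f_4(z)$ for $z\in\mathbb{F}_2^n$. The Maiorana-McFarland class $\mathcal{M}$ in $n=2r$ variables is the set of functions $f(x,y)=x\cdot\sigma(y)+h(y)$, $x,y\in\mathbb{F}_2^{r}$, with $\sigma$ a permutation of $\mathbb{F}_2^{r}$ and $h$ an arbitrary Boolean function on $\mathbb{F}_2^r$. The completed class $\mathcal{M}^{\#}$ is the set of all functions $z\mapsto f(zB+b)+c\cdot z+d$ with $f\in\mathcal{M}$, $B\in GL(n,\mathbb{F}_2)$, $b,c\in\mathbb{F}_2^n$, $d\in\mathbb{F}_2$. *)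

theory Defs
  imports "Jordan_Normal_Form.VS_Connect" "HOL-Library.Z2"
begin

text \<open>
  The field of two elements is the type \<^typ>\<open>bit\<close>, and its n-dimensional coordinate space is
  \<^term>\<open>carrier_vec n :: bit vec set\<close>. A map between coordinate spaces is a HOL function
  of which only the values on the carrier are ever constrained or used; two such functions
  that agree on the carrier represent the same map. A pair \<open>(x, y)\<close> is
  identified with the concatenated vector \<open>x @\<^sub>v y\<close>.
\<close>

abbreviation F2 :: "nat \<Rightarrow> bit vec set"
  where "F2 n \<equiv> carrier_vec n"

abbreviation F2_space :: "nat \<Rightarrow> (bit, bit vec) module"
  where "F2_space n \<equiv> module_vec TYPE(bit) n"

text \<open>
  Linear independence of the family \<open>(v, w)\<close>. The library predicate speaks about the set
  \<open>{v, w}\<close>, which collapses for \<open>v = w\<close>; hence the extra inequality.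
\<close>

definition lin_indep_pair :: "nat \<Rightarrow> bit vec \<Rightarrow> bit vec \<Rightarrow> bool"
  where "lin_indep_pair n v w \<longleftrightarrow> v \<noteq> w \<and> \<not> module.lin_dep class_ring (F2_space n) {v, w}"

definition has_dim :: "nat \<Rightarrow> bit vec set \<Rightarrow> nat \<Rightarrow> bool"
  where "has_dim n U k \<longleftrightarrow> vectorspace.dim class_ring ((F2_space n)\<lparr>carrier := U\<rparr>) = k"

definition linear_permutation :: "nat \<Rightarrow> (bit vec \<Rightarrow> bit vec) \<Rightarrow> bool"
  where "linear_permutation n A \<longleftrightarrow>
    linear_map class_ring (F2_space n) (F2_space n) A \<and> bij_betw A (F2 n) (F2 n)"

definition second_derivative ::
    "bit vec \<Rightarrow> bit vec \<Rightarrow> (bit vec \<Rightarrow> bit vec) \<Rightarrow> bit vec \<Rightarrow> bit vec"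
  where "second_derivative v w \<pi> y = \<pi> y + \<pi> (y + v) + \<pi> (y + w) + \<pi> (y + v + w)"

definition walsh :: "nat \<Rightarrow> (bit vec \<Rightarrow> bit) \<Rightarrow> bit vec \<Rightarrow> int"
  where "walsh n f \<omega> = (\<Sum>x\<in>F2 n. (- 1) ^ of_bit (f x + \<omega> \<bullet> x))"

definition bent :: "nat \<Rightarrow> (bit vec \<Rightarrow> bit) \<Rightarrow> bool"
  where "bent n f \<longleftrightarrow> even n \<and>
    (\<forall>\<omega>\<in>F2 n. walsh n f \<omega> = 2 ^ (n div 2) \<or> walsh n f \<omega> = - (2 ^ (n div 2)))"

definition concat4 :: "nat \<Rightarrow> (bit vec \<Rightarrow> bit) \<Rightarrow> (bit vec \<Rightarrow> bit) \<Rightarrow> (bit vec \<Rightarrow> bit) \<Rightarrow>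
    (bit vec \<Rightarrow> bit) \<Rightarrow> bit vec \<Rightarrow> bit"
  where "concat4 n f1 f2 f3 f4 u =
    (let z = vec_first u n in
     if u $ n = 0
     then (if u $ (n + 1) = 0 then f1 z else f2 z)
     else (if u $ (n + 1) = 0 then f3 z else f4 z))"

lemma concat4_append:
  assumes "z \<in> F2 n"
  shows "concat4 n f1 f2 f3 f4 (z @\<^sub>v vec_of_list [0, 0]) = f1 z"
    and "concat4 n f1 f2 f3 f4 (z @\<^sub>v vec_of_list [0, 1]) = f2 z"
    and "concat4 n f1 f2 f3 f4 (z @\<^sub>v vec_of_list [1, 0]) = f3 z"
    and "concat4 n f1 f2 f3 f4 (z @\<^sub>v vec_of_list [1, 1]) = f4 z"
proof -
  have "vec_first (z @\<^sub>v w) n = z" for w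
    using assms by (intro eq_vecI) (auto simp: vec_first_def append_vec_def)
  moreover have "(z @\<^sub>v vec_of_list [a, b]) $ n = a" "(z @\<^sub>v vec_of_list [a, b]) $ (n + 1) = b" for a b
    using assms by (auto simp: append_vec_def vec_of_list_index)
  ultimately show
    "concat4 n f1 f2 f3 f4 (z @\<^sub>v vec_of_list [0, 0]) = f1 z"
    "concat4 n f1 f2 f3 f4 (z @\<^sub>v vec_of_list [0, 1]) = f2 z"
    "concat4 n f1 f2 f3 f4 (z @\<^sub>v vec_of_list [1, 0]) = f3 z"
    "concat4 n f1 f2 f3 f4 (z @\<^sub>v vec_of_list [1, 1]) = f4 z"
    by (simp_all only: concat4_def Let_def if_True if_False refl zero_neq_one one_neq_zero)
qed

definition MM :: "nat \<Rightarrow> (bit vec \<Rightarrow> bit) set"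
  where "MM n = {f. \<exists>r \<sigma> h. n = 2 * r \<and> bij_betw \<sigma> (F2 r) (F2 r) \<and>
    (\<forall>x\<in>F2 r. \<forall>y\<in>F2 r. f (x @\<^sub>v y) = x \<bullet> \<sigma> y + h y)}"

definition GL :: "nat \<Rightarrow> bit mat set"
  where "GL n = {B \<in> carrier_mat n n. invertible_mat B}"

text \<open>
  The library multiplies matrices with column vectors only, so the product of a row vector \<open>z\<close>
  with \<open>B\<close> is written with the transpose of \<open>B\<close>.
\<close>

definition MM_completed :: "nat \<Rightarrow> (bit vec \<Rightarrow> bit) set"
  where "MM_completed n = {g. \<exists>f\<in>MM n. \<exists>B\<in>GL n. \<exists>b\<in>F2 n. \<exists>c\<in>F2 n. \<exists>d.
    \<forall>z\<in>F2 n. g z = f (transpose_mat B *\<^sub>v z + b) + c \<bullet> z + d}"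

end

theory Submission
  imports Defs
begin

text \<open>
  A member of the completed Maiorana-McFarland class in \<open>2 r\<close> variables has a subspace of
  dimension \<open>r\<close>, the preimage of \<open>F\<^sub>2\<^sup>r \<times> {0}\<close> under its linear part, on which all second
  derivatives vanish identically. The hypothesis on the second derivatives of \<open>\<pi>\<close> makes
  \<open>F\<^sub>2\<^sup>m \<times> {0}\<close> the only such subspace of dimension at least \<open>m\<close> for \<open>q\<close>.
  Writing \<open>f (z, a, b) = q z + b (q z + g z) + a b\<close>, the part of such a subspace of \<open>f\<close>
  lying in \<open>b = 0\<close> projects to a subspace that serves \<open>q\<close> and \<open>g\<close> at once. It has dimension at
  least \<open>m\<close>, since \<open>(0, 1, 0)\<close> and any \<open>(u, a, 1)\<close> have second derivative \<open>1\<close> and hence cannot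
  both occur. So it and its image under \<open>A\<close> equal \<open>F\<^sub>2\<^sup>m \<times> {0}\<close>, which \<open>A\<close> does not fix.
  Bentness holds because each Walsh coefficient of \<open>f\<close> is twice one of \<open>q\<close> or of \<open>g\<close>, up to sign.
\<close>

text \<open>These rules rewrite bit sums and products into bitwise operations; with them switched
  off, bits keep the ring form that algebraic simplification needs.\<close>

declare add_bit_eq_xor [simp del] mult_bit_eq_and [simp del]

section \<open>Arithmetic, cardinality and splitting of coordinate spaces\<close>

lemma bit_add_self [simp]: "(a :: bit) + a = 0"
  by (cases a) simp_all

lemma UNIV_bit: "(UNIV :: bit set) = {0, 1}"
  using bit.exhaust by auto

lemma vec_add_self: "v \<in> F2 n \<Longrightarrow> v + v = 0\<^sub>v n"
  by (intro eq_vecI) auto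

lemma vec_add_cancel: "u \<in> F2 n \<Longrightarrow> v \<in> F2 n \<Longrightarrow> u + v + v = u"
  by (intro eq_vecI) (auto simp: add.assoc)

lemma vec_add_eq_zero_iff:
  assumes "u \<in> F2 n" "v \<in> F2 n"
  shows "u + v = 0\<^sub>v n \<longleftrightarrow> u = v"
  using vec_add_cancel[OF assms] vec_add_self[OF assms(2)] left_zero_vec[OF assms(2)] by metis

lemma bij_betw_translate: "p \<in> F2 n \<Longrightarrow> bij_betw (\<lambda>x. x + p) (F2 n) (F2 n)"
  by (rule bij_betw_byWitness[where f' = "\<lambda>x. x + p"]) (auto simp: vec_add_cancel)

lemma bij_betw_vec_of_list: "bij_betw vec_of_list {xs :: bit list. set xs \<subseteq> UNIV \<and> length xs = n} (F2 n)"
proof (rule bij_betw_byWitness[where f' = list_of_vec])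
  show "vec_of_list ` {xs :: bit list. set xs \<subseteq> UNIV \<and> length xs = n} \<subseteq> F2 n"
    by (auto intro!: carrier_vecI)
  show "list_of_vec ` F2 n \<subseteq> {xs :: bit list. set xs \<subseteq> UNIV \<and> length xs = n}"
    by auto
qed (simp_all only: list_vec vec_list ball_simps simp_thms Ball_def)

lemma finite_F2 [simp]: "finite (F2 n)"
  using bij_betw_finite[OF bij_betw_vec_of_list] finite_lists_length_eq[of "UNIV :: bit set" n]
  by (simp add: UNIV_bit)

lemma card_F2: "card (F2 n) = 2 ^ n"
  using bij_betw_same_card[OF bij_betw_vec_of_list, of n] card_lists_length_eq[of "UNIV :: bit set" n]
  by (simp add: UNIV_bit numeral_2_eq_2)

lemma bij_betw_append:
  "bij_betw (\<lambda>(x, y). x @\<^sub>v y) (F2 n \<times> F2 k) (F2 (n + k))"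
  by (rule bij_betw_byWitness[where f' = "\<lambda>z. (vec_first z n, vec_last z k)"])
    (auto simp: vec_first_def vec_last_def intro!: eq_vecI)

lemma sum_F2_append:
  "(\<Sum>z\<in>F2 (n + k). h z) = (\<Sum>x\<in>F2 n. \<Sum>y\<in>F2 k. h (x @\<^sub>v y))"
  using sum.reindex_bij_betw[OF bij_betw_append, of h n k]
  by (simp add: sum.cartesian_product case_prod_unfold)

lemma F2_appendE:
  assumes "z \<in> F2 (n + k)"
  obtains x y where "x \<in> F2 n" "y \<in> F2 k" "z = x @\<^sub>v y"
  using vec_first_last_append[OF assms] vec_first_carrier vec_last_carrier by metis

section \<open>Additive maps and functionals\<close>

text \<open>With 0 and 1 as the only scalars, additivity already is linearity. The free result type
  covers functionals as well as vector-valued maps.\<close>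

definition additive_on :: "nat \<Rightarrow> (bit vec \<Rightarrow> 'a :: plus) \<Rightarrow> bool"
  where "additive_on n L \<longleftrightarrow> (\<forall>u\<in>F2 n. \<forall>v\<in>F2 n. L (u + v) = L u + L v)"

lemma additive_onD: "additive_on n L \<Longrightarrow> u \<in> F2 n \<Longrightarrow> v \<in> F2 n \<Longrightarrow> L (u + v) = L u + L v"
  by (simp add: additive_on_def)

lemma additive_on_scalar_prod: "a \<in> F2 n \<Longrightarrow> additive_on n (\<lambda>x. a \<bullet> x)"
  by (auto simp: additive_on_def scalar_prod_add_distrib)

lemma additive_functional_scalar_prod:
  fixes L :: "bit vec \<Rightarrow> bit"
  assumes L: "additive_on n L"
  obtains a where "a \<in> F2 n" "\<And>x. x \<in> F2 n \<Longrightarrow> L x = x \<bullet> a"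
proof
  let ?a = "vec n (\<lambda>i. L (unit_vec n i))"
  show "?a \<in> F2 n" by simp
  fix x :: "bit vec" assume x: "x \<in> F2 n"
  \<comment> \<open>Truncations of \<open>x\<close> to its first \<open>k\<close> coordinates:
    passing from \<open>k\<close> to \<open>k + 1\<close> adds a multiple of one unit vector, so
    additivity drives the induction.\<close>
  let ?t = "\<lambda>k. vec n (\<lambda>i. if i < k then x $ i else 0)"
  have L0: "L (0\<^sub>v n) = 0"
    using additive_onD[OF L, of "0\<^sub>v n" "0\<^sub>v n"] by simp
  have "L (?t k) = (\<Sum>i<k. x $ i * L (unit_vec n i))" if "k \<le> n" for k
    using that
  proof (induction k)
    case 0
    have "?t 0 = 0\<^sub>v n" by auto
    then show ?case using L0 by simp
  next
    case (Suc k)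
    have eq: "?t (Suc k) = ?t k + x $ k \<cdot>\<^sub>v unit_vec n k"
      using Suc.prems by (intro eq_vecI) (auto simp: less_Suc_eq)
    have "L (x $ k \<cdot>\<^sub>v unit_vec n k) = x $ k * L (unit_vec n k)"
    proof (cases "x $ k = 0")
      case True
      moreover have "0 \<cdot>\<^sub>v unit_vec n k = (0\<^sub>v n :: bit vec)" by (intro eq_vecI) auto
      ultimately show ?thesis using L0 by simp
    next
      case False
      then show ?thesis by simp
    qed
    moreover have "L (?t (Suc k)) = L (?t k) + L (x $ k \<cdot>\<^sub>v unit_vec n k)"
      unfolding eq by (rule additive_onD[OF L]) auto
    ultimately show ?case using Suc by simp
  qed
  from this[of n] have "L (?t n) = (\<Sum>i<n. x $ i * L (unit_vec n i))" by simp
  moreover have "?t n = x" using x by (intro eq_vecI) auto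
  ultimately show "L x = x \<bullet> ?a" by (simp add: scalar_prod_def atLeast0LessThan)
qed

section \<open>Sign sums of Maiorana-McFarland functions\<close>

definition sign :: "bit \<Rightarrow> int"
  where "sign a = (- 1) ^ of_bit a"

lemma sign_simps [simp]: "sign 0 = 1" "sign 1 = - 1"
  by (simp_all add: sign_def)

lemma sign_add: "sign (a + b) = sign a * sign b"
  by (cases a; cases b) simp_all

lemma sign_cases: "sign a = 1 \<or> sign a = - 1"
  by (cases a) simp_all

lemma exists_scalar_prod_one:
  assumes "a \<in> F2 n" "a \<noteq> 0\<^sub>v n"
  obtains p where "p \<in> F2 n" "p \<bullet> a = 1"
proof -
  obtain i where i: "i < n" "a $ i \<noteq> 0"
    using assms by (metis carrier_vecD dim_vec eq_vecI index_zero_vec)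
  then have "unit_vec n i \<bullet> a = 1"
    using assms by (simp add: scalar_prod_left_unit)
  then show ?thesis using that[of "unit_vec n i"] by simp
qed

text \<open>For nonzero \<open>a\<close>, translating by some \<open>p\<close> with
  \<open>p \<bullet> a = 1\<close> flips every sign, so the sum equals its own negative.\<close>

lemma sum_sign_scalar_prod:
  assumes a: "a \<in> F2 n"
  shows "(\<Sum>x\<in>F2 n. sign (x \<bullet> a)) = (if a = 0\<^sub>v n then 2 ^ n else 0)"
proof (cases "a = 0\<^sub>v n")
  case True
  then show ?thesis by (simp add: card_F2)
next
  case False
  then obtain p where p: "p \<in> F2 n" "p \<bullet> a = 1"
    using exists_scalar_prod_one a by blast
  have "(\<Sum>x\<in>F2 n. sign (x \<bullet> a)) = (\<Sum>x\<in>F2 n. sign ((x + p) \<bullet> a))"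
    using sum.reindex_bij_betw[OF bij_betw_translate[OF p(1)], of "\<lambda>x. sign (x \<bullet> a)"] by simp
  also have "\<dots> = (\<Sum>x\<in>F2 n. - sign (x \<bullet> a))"
    using p a by (intro sum.cong) (auto simp: add_scalar_prod_distrib sign_add)
  finally show ?thesis using False by (simp add: sum_negf)
qed

text \<open>Split \<open>L\<close> into \<open>x \<bullet> a\<close> and a part depending on
  \<open>y\<close> alone. Summing over \<open>x\<close> first annihilates every \<open>y\<close>
  except the unique one with \<open>\<pi> y = a\<close>, which contributes a sign times
  \<open>2 ^ m\<close>.\<close>

lemma sum_sign_MM:
  fixes q L :: "bit vec \<Rightarrow> bit"
  assumes \<pi>: "bij_betw \<pi> (F2 m) (F2 m)"
    and q: "\<And>x y. x \<in> F2 m \<Longrightarrow> y \<in> F2 m \<Longrightarrow> q (x @\<^sub>v y) = x \<bullet> \<pi> y"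
    and L: "additive_on (m + m) L"
  shows "(\<Sum>z\<in>F2 (m + m). sign (q z + L z)) \<in> {2 ^ m, - (2 ^ m)}"
proof -
  have split: "L (x @\<^sub>v y) = L (x @\<^sub>v 0\<^sub>v m) + L (0\<^sub>v m @\<^sub>v y)" if "x \<in> F2 m" "y \<in> F2 m" for x y
  proof -
    have "x @\<^sub>v y = (x @\<^sub>v 0\<^sub>v m) + (0\<^sub>v m @\<^sub>v y)"
      using that by (subst append_vec_add[of _ m _ _ m]) auto
    then show ?thesis using that by (simp add: additive_onD[OF L])
  qed
  have "additive_on m (\<lambda>x. L (x @\<^sub>v 0\<^sub>v m))"
    unfolding additive_on_def
  proof (intro ballI)
    fix u v assume uv: "u \<in> F2 m" "v \<in> F2 m"
    have "(u + v) @\<^sub>v 0\<^sub>v m = (u @\<^sub>v 0\<^sub>v m) + (v @\<^sub>v 0\<^sub>v m)"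
      using uv by (subst append_vec_add[of _ m _ _ m]) auto
    then show "L ((u + v) @\<^sub>v 0\<^sub>v m) = L (u @\<^sub>v 0\<^sub>v m) + L (v @\<^sub>v 0\<^sub>v m)"
      using uv by (simp add: additive_onD[OF L])
  qed
  then obtain a where a: "a \<in> F2 m" "\<And>x. x \<in> F2 m \<Longrightarrow> L (x @\<^sub>v 0\<^sub>v m) = x \<bullet> a"
    using additive_functional_scalar_prod by blast
  have \<pi>c: "\<pi> y \<in> F2 m" if "y \<in> F2 m" for y
    using \<pi> that bij_betwE by blast
  obtain y0 where y0: "y0 \<in> F2 m" "\<pi> y0 = a"
    using \<pi> a(1) by (metis bij_betw_imp_surj_on imageE)
  have uniq: "\<pi> y = a \<longleftrightarrow> y = y0" if "y \<in> F2 m" for y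
    using \<pi> y0 that by (metis bij_betw_imp_inj_on inj_onD)
  have "(\<Sum>z\<in>F2 (m + m). sign (q z + L z))
      = (\<Sum>x\<in>F2 m. \<Sum>y\<in>F2 m. sign (L (0\<^sub>v m @\<^sub>v y)) * sign (x \<bullet> (\<pi> y + a)))"
    unfolding sum_F2_append
  proof (intro sum.cong refl)
    fix x y assume xy: "x \<in> F2 m" "y \<in> F2 m"
    have "q (x @\<^sub>v y) + L (x @\<^sub>v y) = L (0\<^sub>v m @\<^sub>v y) + x \<bullet> (\<pi> y + a)"
      using xy a \<pi>c split[OF xy] by (simp add: q scalar_prod_add_distrib ac_simps)
    then show "sign (q (x @\<^sub>v y) + L (x @\<^sub>v y)) = sign (L (0\<^sub>v m @\<^sub>v y)) * sign (x \<bullet> (\<pi> y + a))"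
      by (simp add: sign_add)
  qed
  also have "\<dots> = (\<Sum>y\<in>F2 m. sign (L (0\<^sub>v m @\<^sub>v y)) * (\<Sum>x\<in>F2 m. sign (x \<bullet> (\<pi> y + a))))"
    by (subst sum.swap) (simp add: sum_distrib_left)
  also have "\<dots> = (\<Sum>y\<in>F2 m. if y = y0 then sign (L (0\<^sub>v m @\<^sub>v y)) * 2 ^ m else 0)"
    using a \<pi>c by (intro sum.cong) (auto simp: sum_sign_scalar_prod vec_add_eq_zero_iff uniq)
  also have "\<dots> = sign (L (0\<^sub>v m @\<^sub>v y0)) * 2 ^ m"
    using y0 by simp
  finally show ?thesis
    using sign_cases[of "L (0\<^sub>v m @\<^sub>v y0)"] by auto
qed

section \<open>Subspaces on which second derivatives vanish\<close>

definition second_diff :: "(bit vec \<Rightarrow> bit) \<Rightarrow> bit vec \<Rightarrow> bit vec \<Rightarrow> bit vec \<Rightarrow> bit"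
  where "second_diff f u v z = f z + f (z + u) + f (z + v) + f (z + u + v)"

text \<open>Over two elements, closure under sums makes a nonempty set a subspace. Dimensions are
  tracked through cardinalities, and a positive lower bound on the cardinality rules out the empty
  set.\<close>

definition flat_on :: "nat \<Rightarrow> (bit vec \<Rightarrow> bit) \<Rightarrow> bit vec set \<Rightarrow> bool"
  where "flat_on n f S \<longleftrightarrow> S \<subseteq> F2 n \<and> (\<forall>u\<in>S. \<forall>v\<in>S. u + v \<in> S) \<and>
    (\<forall>u\<in>S. \<forall>v\<in>S. \<forall>z\<in>F2 n. second_diff f u v z = 0)"

lemma flat_onD:
  assumes "flat_on n f S"
  shows "u \<in> S \<Longrightarrow> u \<in> F2 n"
    and "u \<in> S \<Longrightarrow> v \<in> S \<Longrightarrow> u + v \<in> S"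
    and "u \<in> S \<Longrightarrow> v \<in> S \<Longrightarrow> z \<in> F2 n \<Longrightarrow> second_diff f u v z = 0"
  using assms by (auto simp: flat_on_def)

definition fst_axis :: "nat \<Rightarrow> bit vec set"
  where "fst_axis m = {x @\<^sub>v 0\<^sub>v m | x. x \<in> F2 m}"

lemma fst_axis_subset: "fst_axis m \<subseteq> F2 (m + m)"
  by (auto simp: fst_axis_def)

lemma card_fst_axis: "card (fst_axis m) = 2 ^ m"
proof -
  have "fst_axis m = (\<lambda>x. x @\<^sub>v 0\<^sub>v m) ` F2 m"
    by (auto simp: fst_axis_def)
  moreover have "inj_on (\<lambda>x. x @\<^sub>v 0\<^sub>v m) (F2 m)"
    by (rule inj_onI) (metis append_vec_eq)
  ultimately show ?thesis by (simp add: card_image card_F2)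
qed

text \<open>A nontrivial relation with bit coefficients can only read \<open>v = 0\<close>,
  \<open>w = 0\<close> or \<open>v + w = 0\<close>, and the last means \<open>v = w\<close>.\<close>

lemma lin_indep_pairI:
  assumes v: "v \<in> F2 n" "v \<noteq> 0\<^sub>v n" and w: "w \<in> F2 n" "w \<noteq> 0\<^sub>v n" and "v \<noteq> w"
  shows "lin_indep_pair n v w"
proof -
  interpret vec_space "TYPE(bit)" n .
  have False if dep: "lin_dep {v, w}"
  proof -
    obtain a u where a: "lincomb a {v, w} = 0\<^sub>v n" and u: "u \<in> {v, w}" "a u \<noteq> 0"
      using finite_lin_dep[OF _ dep] v w by (auto simp: module_vec_simps class_ring_simps)
    have "lincomb a {v, w} = a v \<cdot>\<^sub>v v + (a w \<cdot>\<^sub>v w + 0\<^sub>v n)"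
      using v w \<open>v \<noteq> w\<close> by (simp add: lincomb_insert2 lincomb_def module_vec_simps)
    then have "a v \<cdot>\<^sub>v v + a w \<cdot>\<^sub>v w = 0\<^sub>v n"
      using a w by simp
    then show False
      using u v w \<open>v \<noteq> w\<close> vec_add_eq_zero_iff[OF v(1) w(1)]
      by (cases "a v"; cases "a w") auto
  qed
  then show ?thesis using \<open>v \<noteq> w\<close> by (auto simp: lin_indep_pair_def)
qed

text \<open>Translation by a point \<open>p\<close> off the hyperplane gives a disjoint copy of
  it.\<close>

lemma double_card_hyperplane_le:
  assumes c: "c \<in> F2 n" "c \<noteq> 0\<^sub>v n"
  shows "2 * card {x \<in> F2 n. x \<bullet> c = 0} \<le> 2 ^ n"
proof -
  let ?H = "{x \<in> F2 n. x \<bullet> c = 0}"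
  obtain p where p: "p \<in> F2 n" "p \<bullet> c = 1"
    using exists_scalar_prod_one[OF c] .
  have "inj_on (\<lambda>x. x + p) ?H"
    using bij_betw_translate[OF p(1)] by (auto simp: bij_betw_def intro: inj_on_subset)
  then have "2 * card ?H = card ?H + card ((\<lambda>x. x + p) ` ?H)"
    by (simp add: card_image)
  also have "\<dots> = card (?H \<union> (\<lambda>x. x + p) ` ?H)"
    using p c by (intro card_Un_disjoint[symmetric]) (auto simp: add_scalar_prod_distrib)
  also have "\<dots> \<le> card (F2 n)"
    using p by (intro card_mono) auto
  finally show ?thesis by (simp add: card_F2)
qed

text \<open>A normal vector is unique up to a nonzero scalar, and the only such scalar is 1.
  Concretely, a \<open>p\<close> with \<open>p \<bullet> (c + c') = 1\<close> lies on exactly one of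
  the two hyperplanes.\<close>

lemma eq_if_same_hyperplane:
  assumes c: "c \<in> F2 n" "c' \<in> F2 n"
    and eq: "{x \<in> F2 n. x \<bullet> c = 0} = {x \<in> F2 n. x \<bullet> c' = 0}"
  shows "c = c'"
proof (rule ccontr)
  assume "c \<noteq> c'"
  then have "c + c' \<noteq> 0\<^sub>v n"
    using vec_add_eq_zero_iff c by blast
  then obtain p where p: "p \<in> F2 n" "p \<bullet> (c + c') = 1"
    using exists_scalar_prod_one[of "c + c'" n] c by auto
  have "p \<bullet> c = 0 \<longleftrightarrow> p \<bullet> c' = 0"
    using eq p(1) by blast
  then have "p \<bullet> c = p \<bullet> c'"
    by (cases "p \<bullet> c"; cases "p \<bullet> c'") simp_all
  then show False
    using p c by (simp add: scalar_prod_add_distrib)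
qed

text \<open>The point of this form is that \<open>x\<close> occurs in the first summand only: for
  fixed \<open>y\<close> the expression is affine in \<open>x\<close>.\<close>

lemma second_diff_MM:
  fixes q :: "bit vec \<Rightarrow> bit"
  assumes \<pi>: "\<And>y. y \<in> F2 m \<Longrightarrow> \<pi> y \<in> F2 m"
    and q: "\<And>x y. x \<in> F2 m \<Longrightarrow> y \<in> F2 m \<Longrightarrow> q (x @\<^sub>v y) = x \<bullet> \<pi> y"
    and [simp]: "u1 \<in> F2 m" "u2 \<in> F2 m" "v1 \<in> F2 m" "v2 \<in> F2 m" "x \<in> F2 m" "y \<in> F2 m"
  shows "second_diff q (u1 @\<^sub>v u2) (v1 @\<^sub>v v2) (x @\<^sub>v y) =
    x \<bullet> second_derivative u2 v2 \<pi> y + u1 \<bullet> (\<pi> (y + u2) + \<pi> (y + u2 + v2))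
      + v1 \<bullet> (\<pi> (y + v2) + \<pi> (y + u2 + v2))"
proof -
  have add: "(a @\<^sub>v b) + (a' @\<^sub>v b') = (a + a') @\<^sub>v (b + b')"
    if "a \<in> F2 m" "b \<in> F2 m" "a' \<in> F2 m" "b' \<in> F2 m" for a b a' b' :: "bit vec"
    by (rule append_vec_add[OF that(1,3,2,4)])
  show ?thesis
    unfolding second_diff_def second_derivative_def
    by (simp add: add q \<pi> scalar_prod_add_distrib[of _ m] add_scalar_prod_distrib[of _ m] ac_simps)
qed

text \<open>An affine function of \<open>x\<close> that vanishes everywhere has zero linear part.
  Hence \<open>second_derivative u2 v2 \<pi>\<close> would vanish at every \<open>y\<close>, which
  \<open>P1\<close> forbids for distinct nonzero \<open>u2\<close> and \<open>v2\<close>.\<close>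

lemma flat_on_MM_snd_dependent:
  fixes q :: "bit vec \<Rightarrow> bit"
  assumes \<pi>: "\<And>y. y \<in> F2 m \<Longrightarrow> \<pi> y \<in> F2 m"
    and q: "\<And>x y. x \<in> F2 m \<Longrightarrow> y \<in> F2 m \<Longrightarrow> q (x @\<^sub>v y) = x \<bullet> \<pi> y"
    and P1: "\<And>v w. v \<in> F2 m \<Longrightarrow> w \<in> F2 m \<Longrightarrow> lin_indep_pair m v w \<Longrightarrow>
           \<exists>y\<in>F2 m. second_derivative v w \<pi> y \<noteq> 0\<^sub>v m"
    and flat: "flat_on (m + m) q S"
    and S: "u1 @\<^sub>v u2 \<in> S" "v1 @\<^sub>v v2 \<in> S"
    and [simp]: "u1 \<in> F2 m" "u2 \<in> F2 m" "v1 \<in> F2 m" "v2 \<in> F2 m"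
    and "u2 \<noteq> 0\<^sub>v m" "v2 \<noteq> 0\<^sub>v m"
  shows "u2 = v2"
proof (rule ccontr)
  assume "u2 \<noteq> v2"
  then obtain y where y: "y \<in> F2 m" "second_derivative u2 v2 \<pi> y \<noteq> 0\<^sub>v m"
    using P1[of u2 v2] lin_indep_pairI[of u2 m v2] \<open>u2 \<noteq> 0\<^sub>v m\<close> \<open>v2 \<noteq> 0\<^sub>v m\<close> by fastforce
  let ?d = "second_derivative u2 v2 \<pi> y"
  have d: "?d \<in> F2 m"
    using y(1) \<pi> by (simp add: second_derivative_def)
  have zero: "second_diff q (u1 @\<^sub>v u2) (v1 @\<^sub>v v2) (x @\<^sub>v y) = 0" if "x \<in> F2 m" for x
    using flat_onD(3)[OF flat S] that y(1) by simp
  \<comment> \<open>The values at \<open>x = p\<close> and at \<open>x = 0\<close> differ by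
    \<open>p \<bullet> ?d = 1\<close>, yet both are zero.\<close>
  obtain p where p: "p \<in> F2 m" "p \<bullet> ?d = 1"
    using exists_scalar_prod_one[OF d y(2)] .
  have "0\<^sub>v m \<bullet> ?d = 0" using d by simp
  then show False
    using zero[of p] zero[of "0\<^sub>v m"] p y(1)
    by (simp add: second_diff_MM[where \<pi> = \<pi> and m = m] \<pi> q add.assoc)
qed

text \<open>An element \<open>(u, w)\<close> of \<open>S\<close> off the axis would leave only
  \<open>0\<close> and \<open>w\<close> as second components, so at least half of \<open>S\<close>
  lies on the axis. That half is then a full hyperplane orthogonal to
  \<open>\<pi> y + \<pi> (y + w)\<close> for every \<open>y\<close>. This makes the derivative of
  \<open>\<pi>\<close> in direction \<open>w\<close> constant, contrary to
  \<open>P1\<close>.\<close>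

lemma flat_on_MM_unique:
  fixes q :: "bit vec \<Rightarrow> bit"
  assumes "m \<ge> 2"
    and bij: "bij_betw \<pi> (F2 m) (F2 m)"
    and q: "\<And>x y. x \<in> F2 m \<Longrightarrow> y \<in> F2 m \<Longrightarrow> q (x @\<^sub>v y) = x \<bullet> \<pi> y"
    and P1: "\<And>v w. v \<in> F2 m \<Longrightarrow> w \<in> F2 m \<Longrightarrow> lin_indep_pair m v w \<Longrightarrow>
           \<exists>y\<in>F2 m. second_derivative v w \<pi> y \<noteq> 0\<^sub>v m"
    and flat: "flat_on (m + m) q S"
    and card: "2 ^ m \<le> card S"
  shows "S = fst_axis m"
proof (cases "S \<subseteq> fst_axis m")
  case True
  then show ?thesis
    using card card_fst_axis fst_axis_subset
    by (metis card_seteq finite_F2 finite_subset)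
next
  case False
  have \<pi>: "\<pi> y \<in> F2 m" if "y \<in> F2 m" for y
    using bij that bij_betwE by blast
  obtain s where s: "s \<in> S" "s \<notin> fst_axis m" using False by blast
  obtain u w where u: "u \<in> F2 m" and w: "w \<in> F2 m" and suw: "s = u @\<^sub>v w"
    using F2_appendE[OF flat_onD(1)[OF flat s(1)]] .
  have w0: "w \<noteq> 0\<^sub>v m" using s(2) u suw by (auto simp: fst_axis_def)
  define S1 where "S1 = {x \<in> F2 m. x @\<^sub>v 0\<^sub>v m \<in> S}"
  \<comment> \<open>Elements of \<open>S\<close> with second component \<open>w\<close> are carried
    to the axis by adding \<open>s\<close>, so \<open>S\<close> is covered by two translates of one
    copy of \<open>S1\<close>.\<close>
  have sub: "S \<subseteq> (\<lambda>x. x @\<^sub>v 0\<^sub>v m) ` S1 \<union> (\<lambda>x. (x + u) @\<^sub>v w) ` S1"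
  proof
    fix t assume t: "t \<in> S"
    obtain a b where a: "a \<in> F2 m" and b: "b \<in> F2 m" and tab: "t = a @\<^sub>v b"
      using F2_appendE[OF flat_onD(1)[OF flat t]] .
    show "t \<in> (\<lambda>x. x @\<^sub>v 0\<^sub>v m) ` S1 \<union> (\<lambda>x. (x + u) @\<^sub>v w) ` S1"
    proof (cases "b = 0\<^sub>v m")
      case True
      then show ?thesis using a t tab by (auto simp: S1_def)
    next
      case False
      then have "b = w"
        using flat_on_MM_snd_dependent[OF \<pi> q P1 flat] t s(1) a b u w w0 tab suw by blast
      moreover have "t + s = (a + u) @\<^sub>v (b + w)"
        unfolding tab suw using a u b w by (rule append_vec_add)
      ultimately have "(a + u) @\<^sub>v 0\<^sub>v m \<in> S"
        using flat_onD(2)[OF flat t s(1)] w by (simp add: vec_add_self)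
      then have "a + u \<in> S1" using a u by (simp add: S1_def)
      moreover have "t = ((a + u) + u) @\<^sub>v w"
        using tab \<open>b = w\<close> by (simp only: vec_add_cancel[OF a u])
      ultimately show ?thesis by blast
    qed
  qed
  have fin: "finite S1" by (simp add: S1_def)
  have "card S \<le> card S1 + card S1"
    using card_mono[OF _ sub] card_Un_le[of "(\<lambda>x. x @\<^sub>v 0\<^sub>v m) ` S1" "(\<lambda>x. (x + u) @\<^sub>v w) ` S1"]
      card_image_le[OF fin, of "\<lambda>x. x @\<^sub>v 0\<^sub>v m"] card_image_le[OF fin, of "\<lambda>x. (x + u) @\<^sub>v w"] fin
    by simp
  then have S1_ge: "2 ^ m \<le> 2 * card S1" using card by simp
  \<comment> \<open>Taken at \<open>(0, y)\<close> in directions \<open>(x, 0)\<close> and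
    \<open>(u, w)\<close>, the second derivative of \<open>q\<close> reduces to this dot
    product.\<close>
  have S1_orth: "S1 \<subseteq> {x \<in> F2 m. x \<bullet> (\<pi> y + \<pi> (y + w)) = 0}" if y: "y \<in> F2 m" for y
  proof
    fix x assume x: "x \<in> S1"
    then have xF: "x \<in> F2 m" and xS: "x @\<^sub>v 0\<^sub>v m \<in> S" by (auto simp: S1_def)
    have "second_diff q (x @\<^sub>v 0\<^sub>v m) (u @\<^sub>v w) (0\<^sub>v m @\<^sub>v y) = 0"
      using flat_onD(3)[OF flat xS s(1)] y suw by simp
    moreover have "second_derivative (0\<^sub>v m) w \<pi> y = 0\<^sub>v m"
      using y w \<pi>
      by (simp add: second_derivative_def vec_add_self[of _ m] vec_add_cancel[of _ m])
    ultimately have "x \<bullet> (\<pi> y + \<pi> (y + w)) = 0"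
      using second_diff_MM[of m \<pi> q x "0\<^sub>v m" u w "0\<^sub>v m" y] \<pi> q xF u w y
      by (simp add: vec_add_self[of _ m])
    then show "x \<in> {x \<in> F2 m. x \<bullet> (\<pi> y + \<pi> (y + w)) = 0}" using xF by simp
  qed
  \<comment> \<open>Injectivity of \<open>\<pi>\<close> makes the normal vector nonzero, so the
    hyperplane has at most half of the \<open>2 ^ m\<close> points, while \<open>S1\<close> has at
    least half.\<close>
  have S1_eq: "S1 = {x \<in> F2 m. x \<bullet> (\<pi> y + \<pi> (y + w)) = 0}" if y: "y \<in> F2 m" for y
  proof (rule card_seteq[OF _ S1_orth[OF y]])
    have "y + w \<noteq> y"
      using w0 y w by (metis comm_add_vec vec_add_cancel vec_add_self)
    then have "\<pi> y \<noteq> \<pi> (y + w)"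
      using bij y w by (metis add_carrier_vec bij_betw_imp_inj_on inj_onD)
    then have "\<pi> y + \<pi> (y + w) \<noteq> 0\<^sub>v m"
      using vec_add_eq_zero_iff \<pi> y w by simp
    then have "2 * card {x \<in> F2 m. x \<bullet> (\<pi> y + \<pi> (y + w)) = 0} \<le> 2 ^ m"
      using double_card_hyperplane_le \<pi> y w by simp
    then show "card {x \<in> F2 m. x \<bullet> (\<pi> y + \<pi> (y + w)) = 0} \<le> card S1"
      using S1_ge by linarith
  qed simp
  \<comment> \<open>Since \<open>2 ^ m\<close> is at least 4, some direction \<open>w'\<close> is
    independent of \<open>w\<close>.\<close>
  have "\<not> F2 m \<subseteq> {0\<^sub>v m, w}"
  proof
    assume "F2 m \<subseteq> {0\<^sub>v m, w}"
    then have "card (F2 m) \<le> card {0\<^sub>v m, w}" by (intro card_mono) auto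
    moreover have "(2::nat) ^ 2 \<le> 2 ^ m" using \<open>m \<ge> 2\<close> by (intro power_increasing) auto
    ultimately show False using card_2_iff' w0 by (auto simp: card_F2)
  qed
  then obtain w' where w': "w' \<in> F2 m" "w' \<noteq> 0\<^sub>v m" "w \<noteq> w'" by blast
  then obtain y where y: "y \<in> F2 m" "second_derivative w w' \<pi> y \<noteq> 0\<^sub>v m"
    using P1[OF w w'(1)] lin_indep_pairI[OF w w0] by blast
  \<comment> \<open>Both \<open>y\<close> and \<open>y + w'\<close> describe the same hyperplane
    \<open>S1\<close>, so their normal vectors agree. These are the two halves of
    \<open>second_derivative w w' \<pi> y\<close>, which therefore cancel, against the choice of
    \<open>y\<close>.\<close>
  have "\<pi> y + \<pi> (y + w) = \<pi> (y + w') + \<pi> (y + w' + w)"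
    by (rule eq_if_same_hyperplane[of _ m])
      (use S1_eq[of y] S1_eq[of "y + w'"] y(1) w' w \<pi> in auto)
  moreover have "second_derivative w w' \<pi> y = (\<pi> y + \<pi> (y + w)) + (\<pi> (y + w') + \<pi> (y + w' + w))"
  proof -
    have "y + w + w' = y + w' + w"
      using y w w' by (intro eq_vecI) (auto simp: ac_simps)
    then show ?thesis
      using y w w' \<pi> by (simp add: second_derivative_def assoc_add_vec[of _ m])
  qed
  ultimately show ?thesis
    using y w w' \<pi> vec_add_self[of "\<pi> (y + w') + \<pi> (y + w' + w)" m] by simp
qed

section \<open>Flat subspaces for the completed class\<close>

text \<open>The affine summand \<open>c \<bullet> z + d\<close> has zero second derivative,
  \<open>L\<close> transports the directions and \<open>b\<close> merely shifts the base point.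
  Flatness thus survives the equivalence that defines the completed class.\<close>

lemma second_diff_affine:
  assumes L: "additive_on n L" "\<And>z. z \<in> F2 n \<Longrightarrow> L z \<in> F2 n"
    and f: "\<And>z. z \<in> F2 n \<Longrightarrow> f z = h (L z + b) + c \<bullet> z + d"
    and [simp]: "b \<in> F2 n" "c \<in> F2 n" "u \<in> F2 n" "v \<in> F2 n" "z \<in> F2 n"
  shows "second_diff f u v z = second_diff h (L u) (L v) (L z + b)"
proof -
  have eqs: "L (z + u) + b = L z + b + L u" "L (z + v) + b = L z + b + L v"
    "L (z + u + v) + b = L z + b + L u + L v"
  proof -
    have swap: "x + y + b = x + b + y" if "x \<in> F2 n" "y \<in> F2 n" for x y
      using that by (intro eq_vecI) (auto simp: ac_simps)
    show "L (z + u) + b = L z + b + L u" "L (z + v) + b = L z + b + L v"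
      "L (z + u + v) + b = L z + b + L u + L v"
      by (simp_all add: additive_onD[OF L(1)] L(2) swap)
  qed
  have "c \<bullet> z + d + (c \<bullet> (z + u) + d) + (c \<bullet> (z + v) + d) + (c \<bullet> (z + u + v) + d) = 0"
    by (simp add: scalar_prod_add_distrib[of _ n]; cases d; cases "c \<bullet> z"; cases "c \<bullet> u"; cases "c \<bullet> v"; simp)
  then have "h (L z + b) + (c \<bullet> z + d) + (h (L z + b + L u) + (c \<bullet> (z + u) + d))
      + (h (L z + b + L v) + (c \<bullet> (z + v) + d)) + (h (L z + b + L u + L v) + (c \<bullet> (z + u + v) + d))
     = h (L z + b) + h (L z + b + L u) + h (L z + b + L v) + h (L z + b + L u + L v)"
    by (simp add: algebra_simps)
  then show ?thesis
    by (simp add: second_diff_def f eqs add.assoc)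
qed

text \<open>Moving along the axis leaves \<open>y\<close> fixed, and for fixed \<open>y\<close> the
  function is affine in \<open>x\<close>.\<close>

lemma flat_on_MM_fst_axis:
  assumes \<sigma>: "\<And>y. y \<in> F2 r \<Longrightarrow> \<sigma> y \<in> F2 r"
    and h: "\<And>x y. x \<in> F2 r \<Longrightarrow> y \<in> F2 r \<Longrightarrow> h (x @\<^sub>v y) = x \<bullet> \<sigma> y + k y"
  shows "flat_on (r + r) h (fst_axis r)"
  unfolding flat_on_def
proof (intro conjI ballI)
  have add: "(a @\<^sub>v b) + (a' @\<^sub>v 0\<^sub>v r) = (a + a') @\<^sub>v b"
    if "a \<in> F2 r" "b \<in> F2 r" "a' \<in> F2 r" for a b a' :: "bit vec"
    using append_vec_add[OF that(1,3,2) zero_carrier_vec] that by simp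
  fix u v assume "u \<in> fst_axis r" "v \<in> fst_axis r"
  then obtain a b where a: "a \<in> F2 r" "u = a @\<^sub>v 0\<^sub>v r" and b: "b \<in> F2 r" "v = b @\<^sub>v 0\<^sub>v r"
    by (auto simp: fst_axis_def)
  show "u + v \<in> fst_axis r"
    using a b by (auto simp: fst_axis_def add)
  fix z assume "z \<in> F2 (r + r)"
  then obtain x y where z: "x \<in> F2 r" "y \<in> F2 r" "z = x @\<^sub>v y"
    using F2_appendE by blast
  show "second_diff h u v z = 0"
    using a b z \<sigma>
    by (simp add: second_diff_def add h add_scalar_prod_distrib[of _ r])
qed (rule fst_axis_subset)

lemma bij_betw_mult_mat_vec_transpose_GL:
  assumes "B \<in> GL n"
  shows "bij_betw (\<lambda>z. transpose_mat B *\<^sub>v z) (F2 n) (F2 n)"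
proof -
  have B: "B \<in> carrier_mat n n" and "invertible_mat B"
    using assms by (auto simp: GL_def)
  then obtain C where C: "B * C = 1\<^sub>m n" "C * B = 1\<^sub>m (dim_row C)"
    by (auto simp: invertible_mat_def inverts_mat_def)
  \<comment> \<open>Both dimensions of \<open>C\<close> are read off by comparing the two products
    with identity matrices.\<close>
  have Cc: "C \<in> carrier_mat n n"
    using B C by (metis carrier_matD(2) carrier_matI index_mult_mat(3) index_one_mat(3))
  have t: "transpose_mat C * transpose_mat B = 1\<^sub>m n" "transpose_mat B * transpose_mat C = 1\<^sub>m n"
    using C Cc by (simp_all flip: transpose_mult[OF B Cc] transpose_mult[OF Cc B])
  show ?thesis
  proof (rule bij_betw_byWitness[where f' = "\<lambda>z. transpose_mat C *\<^sub>v z"])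
    show "\<forall>z\<in>F2 n. transpose_mat C *\<^sub>v (transpose_mat B *\<^sub>v z) = z"
      using t B Cc by (simp flip: assoc_mult_mat_vec[of _ n n _ n])
    show "\<forall>z\<in>F2 n. transpose_mat B *\<^sub>v (transpose_mat C *\<^sub>v z) = z"
      using t B Cc by (simp flip: assoc_mult_mat_vec[of _ n n _ n])
  qed (use B Cc in auto)
qed

text \<open>This is the necessity half of Dillon's criterion. The axis is pulled back along the
  bijective linear part, which preserves its size.\<close>

lemma MM_completed_flat_on:
  assumes "f \<in> MM_completed (2 * r)"
  obtains V where "flat_on (2 * r) f V" "card V = 2 ^ r" 
proof -
  let ?n = "r + r"
  have r2: "2 * r = ?n" by simp
  obtain h B b c d where h: "h \<in> MM ?n" and B: "B \<in> GL ?n" and bc: "b \<in> F2 ?n" "c \<in> F2 ?n"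
    and f: "\<And>z. z \<in> F2 ?n \<Longrightarrow> f z = h (transpose_mat B *\<^sub>v z + b) + c \<bullet> z + d"
    using assms unfolding MM_completed_def r2 by blast
  obtain \<sigma> k where \<sigma>: "bij_betw \<sigma> (F2 r) (F2 r)"
    and hk: "\<And>x y. x \<in> F2 r \<Longrightarrow> y \<in> F2 r \<Longrightarrow> h (x @\<^sub>v y) = x \<bullet> \<sigma> y + k y"
    using h by (auto simp: MM_def simp flip: mult_2)
  have flat: "flat_on ?n h (fst_axis r)"
    using \<sigma> by (intro flat_on_MM_fst_axis[of r \<sigma> h k] hk) (auto dest: bij_betwE)
  let ?L = "\<lambda>z. transpose_mat B *\<^sub>v z"
  have bij: "bij_betw ?L (F2 ?n) (F2 ?n)"
    by (rule bij_betw_mult_mat_vec_transpose_GL[OF B])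
  have Lc: "?L z \<in> F2 ?n" if "z \<in> F2 ?n" for z
    using bij that bij_betwE by blast
  have L: "additive_on ?n ?L"
    using B by (auto simp: additive_on_def GL_def intro!: mult_add_distrib_mat_vec)
  define V where "V = {z \<in> F2 ?n. ?L z \<in> fst_axis r}"
  have "?L ` V = fst_axis r"
    using bij fst_axis_subset[of r] by (auto simp: V_def bij_betw_def image_iff)
  moreover have "inj_on ?L V"
    using bij by (auto simp: V_def bij_betw_def intro: inj_on_subset)
  ultimately have "card V = 2 ^ r"
    by (metis card_fst_axis card_image)
  moreover have "flat_on ?n f V"
    unfolding flat_on_def
  proof (intro conjI ballI)
    fix u v assume uv: "u \<in> V" "v \<in> V"
    show "u + v \<in> V"
      using uv flat_onD(2)[OF flat] by (auto simp: V_def additive_onD[OF L])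
    fix z assume "z \<in> F2 ?n"
    then show "second_diff f u v z = 0"
      using uv bc flat_onD(3)[OF flat] Lc
      by (subst second_diff_affine[OF L Lc f]) (auto simp: V_def)
  qed (auto simp: V_def)
  ultimately show ?thesis using that r2 by simp
qed

section \<open>The concatenation: coordinates and bentness\<close>

definition ext2 :: "bit vec \<Rightarrow> bit \<Rightarrow> bit \<Rightarrow> bit vec"
  where "ext2 z a b = z @\<^sub>v vec_of_list [a, b]"

lemma bij_betw_F2_2: "bij_betw (\<lambda>(a, b). vec_of_list [a, b]) UNIV (F2 2)"
proof (rule bij_betw_byWitness[where f' = "\<lambda>v. (v $ 0, v $ 1)"])
  show "\<forall>v\<in>F2 2. (case (v $ 0, v $ 1) of (a, b) \<Rightarrow> vec_of_list [a, b]) = v"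
  proof
    fix v :: "bit vec" assume "v \<in> F2 2"
    then show "(case (v $ 0, v $ 1) of (a, b) \<Rightarrow> vec_of_list [a, b]) = v"
      by (intro eq_vecI) (auto simp: vec_of_list_index less_2_cases_iff)
  qed
qed (auto simp: vec_of_list_index intro!: carrier_vecI)

lemma vec_of_list_2_carrier: "vec_of_list [a, b] \<in> F2 2"
  by (auto intro!: carrier_vecI)

lemma sum_F2_ext2: "(\<Sum>z\<in>F2 (n + 2). h z) = (\<Sum>z\<in>F2 n. \<Sum>a\<in>UNIV. \<Sum>b\<in>UNIV. h (ext2 z a b))"
proof -
  have "(\<Sum>v\<in>F2 2. k v) = (\<Sum>a\<in>UNIV. \<Sum>b\<in>UNIV. k (vec_of_list [a, b]))" for k :: "bit vec \<Rightarrow> 'a"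
    unfolding sum.cartesian_product UNIV_Times_UNIV
    using sum.reindex_bij_betw[OF bij_betw_F2_2, of k, symmetric] by (simp only: case_prod_unfold)
  then show ?thesis by (simp only: sum_F2_append ext2_def)
qed

lemma ext2_carrier: "z \<in> F2 n \<Longrightarrow> ext2 z a b \<in> F2 (n + 2)"
  unfolding ext2_def by (rule append_carrier_vec[OF _ vec_of_list_2_carrier])

lemma ext2E:
  assumes "v \<in> F2 (n + 2)"
  obtains z a b where "z \<in> F2 n" "v = ext2 z a b"
proof -
  obtain z w where z: "z \<in> F2 n" and w: "w \<in> F2 2" and v: "v = z @\<^sub>v w"
    using F2_appendE[OF assms] .
  have "w \<in> range (\<lambda>(a, b). vec_of_list [a, b])"
    using w bij_betw_imp_surj_on[OF bij_betw_F2_2] by blast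
  then obtain a b where "w = vec_of_list [a, b]"
    by (metis (no_types, lifting) case_prod_conv imageE surj_pair)
  then show ?thesis using that z v unfolding ext2_def by blast
qed

lemma vec_first_ext2: "z \<in> F2 n \<Longrightarrow> vec_first (ext2 z a b) n = z"
  by (intro eq_vecI) (auto simp: vec_first_def ext2_def)

lemma ext2_add:
  assumes "z \<in> F2 n" "z' \<in> F2 n"
  shows "ext2 z a b + ext2 z' a' b' = ext2 (z + z') (a + a') (b + b')"
proof -
  have "vec_of_list [a, b] + vec_of_list [a', b'] = vec_of_list [a + a', b + b']"
    by (intro eq_vecI) (auto simp: less_Suc_eq)
  then show ?thesis
    unfolding ext2_def
    using append_vec_add[OF assms vec_of_list_2_carrier vec_of_list_2_carrier] by metis
qed

text \<open>The last bit \<open>b\<close> selects between \<open>q\<close> and \<open>g\<close>. The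
  bit \<open>a\<close> has an effect only when \<open>b = 1\<close>, because \<open>q\<close> fills
  both quarters with \<open>b = 0\<close>.\<close>

lemma concat4_ext2:
  assumes "z \<in> F2 n"
  shows "concat4 n q g q (\<lambda>z. g z + 1) (ext2 z a b) = (if b = 0 then q z else g z + a)"
  using concat4_append[OF assms, of q g q "\<lambda>z. g z + 1"] unfolding ext2_def by (cases a; cases b) simp_all

text \<open>Summing over the two extra bits turns the Walsh coefficient into a combination of one
  sum for \<open>q\<close> and one for \<open>g\<close>. According to \<open>c\<close>, one
  coefficient is 0 and the other is 2 or -2, which raises the exponent \<open>k\<close> by
  one.\<close>

lemma bent_concat4:
  assumes q: "\<And>L. additive_on n L \<Longrightarrow> (\<Sum>z\<in>F2 n. sign (q z + L z)) \<in> {2 ^ k, - (2 ^ k)}"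
    and g: "\<And>L. additive_on n L \<Longrightarrow> (\<Sum>z\<in>F2 n. sign (g z + L z)) \<in> {2 ^ k, - (2 ^ k)}"
    and n: "n = 2 * k"
  shows "bent (n + 2) (concat4 n q g q (\<lambda>z. g z + 1))"
  unfolding bent_def
proof (intro conjI ballI)
  show "even (n + 2)" using n by simp
  fix \<omega> :: "bit vec" assume "\<omega> \<in> F2 (n + 2)"
  then obtain \<alpha> c d where \<alpha>: "\<alpha> \<in> F2 n" and \<omega>: "\<omega> = ext2 \<alpha> c d"
    using ext2E by blast
  let ?f = "concat4 n q g q (\<lambda>z. g z + 1)"
  let ?Q = "\<Sum>z\<in>F2 n. sign (q z + \<alpha> \<bullet> z)" and ?G = "\<Sum>z\<in>F2 n. sign (g z + \<alpha> \<bullet> z)"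
  have dot: "\<omega> \<bullet> ext2 z a b = \<alpha> \<bullet> z + (c * a + d * b)" if "z \<in> F2 n" for z a b
  proof -
    have "vec_of_list [c, d] \<bullet> vec_of_list [a, b] = c * a + d * b"
      by (simp add: scalar_prod_def vec_of_list_index numeral_2_eq_2 atLeast0LessThan lessThan_Suc)
    then show ?thesis
      unfolding \<omega> ext2_def
      by (simp only: scalar_prod_append[OF \<alpha> vec_of_list_2_carrier that vec_of_list_2_carrier])
  qed
  have "walsh (n + 2) ?f \<omega> = (\<Sum>z\<in>F2 n. \<Sum>a\<in>UNIV. \<Sum>b\<in>UNIV.
      sign ((if b = 0 then q z else g z + a) + (\<alpha> \<bullet> z + (c * a + d * b))))"
    unfolding walsh_def sum_F2_ext2 by (intro sum.cong refl) (simp add: concat4_ext2 dot sign_def)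
  also have "\<dots> = (\<Sum>z\<in>F2 n. (1 + sign c) * sign (q z + \<alpha> \<bullet> z)
      + sign d * (1 - sign c) * sign (g z + \<alpha> \<bullet> z))"
    by (intro sum.cong refl) (simp add: UNIV_bit sign_add algebra_simps)
  also have "\<dots> = (1 + sign c) * ?Q + sign d * (1 - sign c) * ?G"
    by (simp add: sum.distrib sum_distrib_left)
  finally have W: "walsh (n + 2) ?f \<omega> = (1 + sign c) * ?Q + sign d * (1 - sign c) * ?G" .
  have "?Q \<in> {2 ^ k, - (2 ^ k)}" "?G \<in> {2 ^ k, - (2 ^ k)}"
    using q g additive_on_scalar_prod[OF \<alpha>] by blast+
  moreover have "(n + 2) div 2 = Suc k" using n by simp
  ultimately show "walsh (n + 2) ?f \<omega> = 2 ^ ((n + 2) div 2) \<or> walsh (n + 2) ?f \<omega> = - (2 ^ ((n + 2) div 2))"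
    unfolding W by (cases c; cases d) auto
qed

text \<open>Substituting the inverse of \<open>A\<close> moves it from \<open>q\<close> into the
  functional. Sums for \<open>q \<circ> A\<close> thereby become sums for \<open>q\<close>, provided
  these are controlled for every additive functional.\<close>

lemma sum_sign_comp_linear:
  assumes A: "additive_on n A" "bij_betw A (F2 n) (F2 n)" and L: "additive_on n L"
  obtains L' where "additive_on n L'" "(\<Sum>z\<in>F2 n. sign (q (A z) + L z)) = (\<Sum>z\<in>F2 n. sign (q z + L' z))"
proof
  let ?I = "inv_into (F2 n) A"
  have I: "bij_betw ?I (F2 n) (F2 n)" using A(2) by (rule bij_betw_inv_into)
  have Ic: "?I z \<in> F2 n" if "z \<in> F2 n" for z using I that bij_betwE by blast
  have AI: "A (?I z) = z" if "z \<in> F2 n" for z using A(2) that by (rule bij_betw_inv_into_right)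
  have IA: "?I (A z) = z" if "z \<in> F2 n" for z using A(2) that by (rule bij_betw_inv_into_left)
  show "additive_on n (\<lambda>z. L (?I z))"
    unfolding additive_on_def
  proof (intro ballI)
    fix u v assume uv: "u \<in> F2 n" "v \<in> F2 n"
    have "?I (u + v) = ?I (A (?I u + ?I v))"
      using uv by (simp add: additive_onD[OF A(1)] Ic AI)
    also have "\<dots> = ?I u + ?I v" using uv by (simp add: IA Ic)
    finally show "L (?I (u + v)) = L (?I u) + L (?I v)"
      using uv by (simp add: additive_onD[OF L] Ic)
  qed
  show "(\<Sum>z\<in>F2 n. sign (q (A z) + L z)) = (\<Sum>z\<in>F2 n. sign (q z + L (?I z)))"
    by (subst sum.reindex_bij_betw[OF A(2), of "\<lambda>z. sign (q z + L (?I z))", symmetric]) (simp add: IA)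
qed

section \<open>From flat subspaces of the concatenation to common ones of its parts\<close>

text \<open>Two steps could each halve the size: restricting \<open>V\<close> to
  \<open>b = 0\<close>, and forgetting the bit \<open>a\<close>. The second loses nothing whenever
  the first is a proper restriction, so only one factor 2 is lost.\<close>

lemma flat_on_concat4:
  assumes flat: "flat_on (n + 2) (concat4 n q g q (\<lambda>z. g z + 1)) V"
    and card: "2 * k \<le> card V" "0 < k"
  obtains S where "flat_on n q S" "flat_on n g S" "k \<le> card S"
proof -
  let ?f = "concat4 n q g q (\<lambda>z. g z + 1)"
  define S where "S = {u \<in> F2 n. \<exists>a. ext2 u a 0 \<in> V}"
  define V0 where "V0 = {v \<in> V. \<exists>u\<in>F2 n. \<exists>a. v = ext2 u a 0}"
  have finS: "finite S" by (simp add: S_def)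
  have VF: "V \<subseteq> F2 (n + 2)" using flat by (simp add: flat_on_def)
  have finV: "finite V" using VF finite_F2 finite_subset by blast
  have S: "second_diff q u v z = 0 \<and> second_diff g u v z = 0"
    if uS: "u \<in> S" and vS: "v \<in> S" and z: "z \<in> F2 n" for u v z
  proof -
    obtain a b where uv: "u \<in> F2 n" "ext2 u a 0 \<in> V" "v \<in> F2 n" "ext2 v b 0 \<in> V"
      using uS vS unfolding S_def by blast
    \<comment> \<open>The last bit \<open>c\<close> of the base point selects the function being
      differentiated. The directions have last bit 0 and keep that choice; for \<open>c = 1\<close>
      the extra bits \<open>a\<close>, \<open>b\<close> and \<open>a + b\<close> sum to
      zero.\<close>
    have "second_diff ?f (ext2 u a 0) (ext2 v b 0) (ext2 z 0 c)
        = (if c = 0 then second_diff q u v z else second_diff g u v z)" for c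
    proof -
      have "x + (y + a) + (x' + b) + (y' + (a + b)) = x + y + x' + y'" for x y x' y' :: bit
        by (cases x; cases y; cases x'; cases y'; cases a; cases b; simp)
      then show ?thesis
        using uv(1,3) z by (simp add: second_diff_def ext2_add[of _ n] concat4_ext2[of _ n])
    qed
    moreover have "second_diff ?f (ext2 u a 0) (ext2 v b 0) (ext2 z 0 c) = 0" for c
      using flat_onD(3)[OF flat uv(2,4) ext2_carrier[OF z]] .
    ultimately show ?thesis by (metis zero_neq_one)
  qed
  have S_add: "u + v \<in> S" if uS: "u \<in> S" and vS: "v \<in> S" for u v
  proof -
    obtain a b where uv: "u \<in> F2 n" "ext2 u a 0 \<in> V" "v \<in> F2 n" "ext2 v b 0 \<in> V"
      using uS vS unfolding S_def by blast
    have "ext2 (u + v) (a + b) 0 \<in> V"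
      using flat_onD(2)[OF flat uv(2,4)] uv by (simp add: ext2_add[of _ n])
    then show ?thesis using uv unfolding S_def by auto
  qed
  have "k \<le> card S"
  proof (cases "V \<subseteq> V0")
    case True
    \<comment> \<open>No restriction occurs here, and each element of \<open>S\<close> has at most
      two lifts.\<close>
    have "V \<subseteq> (\<lambda>(u, a). ext2 u a 0) ` (S \<times> UNIV)"
      using True by (fastforce simp: V0_def S_def)
    then have "card V \<le> card (S \<times> (UNIV :: bit set))"
      using finS by (intro surj_card_le) (auto simp: UNIV_bit)
    then show ?thesis using card by (simp add: card_cartesian_product UNIV_bit)
  next
    case False
    then obtain w where w: "w \<in> V" "w \<notin> V0" by blast
    then obtain u a b where u: "u \<in> F2 n" and wu: "w = ext2 u a b"
      using VF ext2E by blast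
    have b: "b = 1"
    proof (rule ccontr)
      assume "b \<noteq> 1"
      then have "w \<in> V0" using w u wu by (auto simp: V0_def)
      with w show False by blast
    qed
    \<comment> \<open>At base point 0 the two \<open>q\<close> terms cancel, while the two
      \<open>g\<close> terms differ by the flipped bit \<open>a\<close>, leaving 1.\<close>
    have no_e: "ext2 (0\<^sub>v n) 1 0 \<notin> V"
    proof
      assume "ext2 (0\<^sub>v n) 1 0 \<in> V"
      then have "second_diff ?f (ext2 (0\<^sub>v n) 1 0) w (ext2 (0\<^sub>v n) 0 0) = 0"
        using flat_onD(3)[OF flat] w(1) ext2_carrier by simp
      moreover have "second_diff ?f (ext2 (0\<^sub>v n) 1 0) (ext2 u a 1) (ext2 (0\<^sub>v n) 0 0) = 1"
      proof -
        have "x + x + (y + a) + (y + (1 + a)) = 1" for x y :: bit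
          by (cases x; cases y; cases a; simp)
        then show ?thesis
          using u by (simp add: second_diff_def ext2_add[of _ n] concat4_ext2[of _ n])
      qed
      ultimately show False using b wu by simp
    qed
    \<comment> \<open>Two distinct elements with the same projection would sum to the excluded
      vector \<open>ext2 (0\<^sub>v n) 1 0\<close>.\<close>
    have "inj_on (\<lambda>v. vec_first v n) V0"
    proof (rule inj_onI)
      fix v v' assume "v \<in> V0" "v' \<in> V0" and eq: "vec_first v n = vec_first v' n"
      then obtain x c x' c' where x: "x \<in> F2 n" "v = ext2 x c 0" "v \<in> V"
        and x': "x' \<in> F2 n" "v' = ext2 x' c' 0" "v' \<in> V"
        by (auto simp: V0_def)
      have "x = x'" using eq x x' by (simp add: vec_first_ext2)
      moreover have "c = c'"
      proof (rule ccontr)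
        assume "c \<noteq> c'"
        then have "c + c' = 1" by (cases c; cases c') simp_all
        moreover have "v + v' \<in> V" using flat_onD(2)[OF flat] x x' by blast
        ultimately show False
          using no_e x x' \<open>x = x'\<close> by (simp add: ext2_add[of _ n] vec_add_self)
      qed
      ultimately show "v = v'" using x x' by simp
    qed
    moreover have "(\<lambda>v. vec_first v n) ` V0 \<subseteq> S"
      by (auto simp: V0_def S_def vec_first_ext2)
    ultimately have "card V0 \<le> card S"
      using finS by (metis card_inj_on_le)
    moreover have "card V \<le> card V0 + card V0"
    proof -
      \<comment> \<open>Adding \<open>w\<close> resets the last bit to 0, so \<open>V - V0\<close>
        lies in a translate of \<open>V0\<close> and \<open>V0\<close> is at least half of
        \<open>V\<close>.\<close>
      have "V - V0 \<subseteq> (\<lambda>v. v + w) ` V0"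
      proof
        fix v assume v: "v \<in> V - V0"
        then obtain x c e where x: "x \<in> F2 n" and vx: "v = ext2 x c e"
          using VF ext2E by blast
        have "e = 1"
        proof (rule ccontr)
          assume "e \<noteq> 1"
          then have "v \<in> V0" using v x vx by (auto simp: V0_def)
          with v show False by blast
        qed
        then have "v + w = ext2 (x + u) (c + a) 0"
          using vx wu b x u by (simp add: ext2_add[of _ n])
        moreover have "v + w \<in> V" using flat_onD(2)[OF flat] v w by blast
        ultimately have "v + w \<in> V0" using x u by (auto simp: V0_def)
        moreover have "v = v + w + w"
          using vec_add_cancel[of v "n + 2" w] VF v w by (metis DiffD1 subsetD)
        ultimately show "v \<in> (\<lambda>v. v + w) ` V0" by blast
      qed
      moreover have finV0: "finite V0" using finV by (simp add: V0_def)
      ultimately have "card (V - V0) \<le> card V0"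
        using surj_card_le by blast
      moreover have "V0 \<subseteq> V" by (auto simp: V0_def)
      then have "card V = card V0 + card (V - V0)"
        using card_Diff_subset[OF finV0] card_mono[OF finV] by fastforce
      ultimately show ?thesis by simp
    qed
    ultimately show ?thesis using card by simp
  qed
  moreover have "flat_on n q S" "flat_on n g S"
    using S S_add by (auto simp: flat_on_def S_def)
  ultimately show ?thesis using that by blast
qed

text \<open>The second derivative of \<open>q \<circ> A\<close> at \<open>t\<close> is that of
  \<open>q\<close> at \<open>A t\<close> in the image directions, and surjectivity of
  \<open>A\<close> reaches every base point.\<close>

lemma flat_on_comp_image:
  assumes A: "additive_on n A" "bij_betw A (F2 n) (F2 n)" and flat: "flat_on n (q \<circ> A) S"
  shows "flat_on n q (A ` S)"
  unfolding flat_on_def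
proof (intro conjI ballI)
  have Ac: "A z \<in> F2 n" if "z \<in> F2 n" for z using A(2) that bij_betwE by blast
  note SF = flat_onD(1)[OF flat]
  show "A ` S \<subseteq> F2 n" using SF Ac by blast
  fix u v assume "u \<in> A ` S" "v \<in> A ` S"
  then obtain x y where x: "x \<in> S" "u = A x" and y: "y \<in> S" "v = A y" by blast
  show "u + v \<in> A ` S"
    using x y flat_onD(2)[OF flat x(1) y(1)] SF
    by (auto simp flip: additive_onD[OF A(1)])
  fix z assume "z \<in> F2 n"
  then obtain t where t: "t \<in> F2 n" "z = A t"
    using A(2) by (metis bij_betw_imp_surj_on imageE)
  show "second_diff q u v z = 0"
    using flat_onD(3)[OF flat x(1) y(1) t(1)] SF[OF x(1)] SF[OF y(1)] x(2) y(2) t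
    by (simp add: second_diff_def additive_onD[OF A(1)] del: assoc_add_vec)
qed

theorem theorem4p9:
  fixes m :: nat
    and \<pi> A :: "bit vec \<Rightarrow> bit vec"
    and q g f :: "bit vec \<Rightarrow> bit"
    and U :: "bit vec set"
  assumes "m \<ge> 3"
    and "bij_betw \<pi> (F2 m) (F2 m)"
    and "\<And>v w. v \<in> F2 m \<Longrightarrow> w \<in> F2 m \<Longrightarrow> lin_indep_pair m v w \<Longrightarrow>
           \<exists>y\<in>F2 m. second_derivative v w \<pi> y \<noteq> 0\<^sub>v m"
    and "\<And>x y. x \<in> F2 m \<Longrightarrow> y \<in> F2 m \<Longrightarrow> q (x @\<^sub>v y) = x \<bullet> \<pi> y"
    and "linear_permutation (2 * m) A"
    and "subspace class_ring U (F2_space (2 * m))"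
    and "U \<subseteq> {x @\<^sub>v 0\<^sub>v m | x. x \<in> F2 m}"
    and "has_dim (2 * m) U (m - 1)"
    and "A ` U = U"
    and "A ` {x @\<^sub>v 0\<^sub>v m | x. x \<in> F2 m} \<noteq> {x @\<^sub>v 0\<^sub>v m | x. x \<in> F2 m}"
    and "g = q \<circ> A"
    and "f = concat4 (2 * m) q g q (\<lambda>z. g z + 1)"
  shows "bent (2 * m + 2) f \<and> f \<notin> MM_completed (2 * m + 2)"
proof
  note \<pi> = assms(2) and P1 = assms(3) and q = assms(4)
  have A_bij: "bij_betw A (F2 (2 * m)) (F2 (2 * m))"
    using assms(5) by (simp add: linear_permutation_def)
  interpret linear_map class_ring "F2_space (2 * m)" "F2_space (2 * m)" A
    using assms(5) by (simp add: linear_permutation_def)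
  have A_add: "additive_on (2 * m) A"
    using T_add by (auto simp: additive_on_def module_vec_simps)
  have q_sum: "(\<Sum>z\<in>F2 (2 * m). sign (q z + L z)) \<in> {2 ^ m, - (2 ^ m)}" if "additive_on (2 * m) L" for L
    using sum_sign_MM[OF \<pi> q] that by (simp only: mult_2)
  have g_sum: "(\<Sum>z\<in>F2 (2 * m). sign (g z + L z)) \<in> {2 ^ m, - (2 ^ m)}" if "additive_on (2 * m) L" for L
  proof -
    obtain L' where "additive_on (2 * m) L'"
      "(\<Sum>z\<in>F2 (2 * m). sign (q (A z) + L z)) = (\<Sum>z\<in>F2 (2 * m). sign (q z + L' z))"
      using sum_sign_comp_linear[OF A_add A_bij \<open>additive_on (2 * m) L\<close>] .
    then show ?thesis using q_sum[of L'] by (simp only: assms(11) comp_apply)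
  qed
  show "bent (2 * m + 2) f"
    unfolding assms(12) by (rule bent_concat4[OF q_sum g_sum]) simp_all
  show "f \<notin> MM_completed (2 * m + 2)"
  proof
    assume "f \<in> MM_completed (2 * m + 2)"
    then have "f \<in> MM_completed (2 * (m + 1))" by simp
    then obtain V where "flat_on (2 * (m + 1)) f V" and V: "card V = 2 ^ (m + 1)"
      using MM_completed_flat_on by blast
    then have "flat_on (2 * m + 2) (concat4 (2 * m) q g q (\<lambda>z. g z + 1)) V"
      by (simp add: assms(12))
    then obtain S where S: "flat_on (2 * m) q S" "flat_on (2 * m) g S" "2 ^ m \<le> card S"
      using flat_on_concat4[of "2 * m" q g V "2 ^ m"] V by auto
    have unique: "T = fst_axis m" if "flat_on (2 * m) q T" "2 ^ m \<le> card T" for T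
      using flat_on_MM_unique[OF _ \<pi> q P1] that assms(1) by (simp add: mult_2)
    have "flat_on (2 * m) q (A ` S)"
      using flat_on_comp_image[OF A_add A_bij] S(2) assms(11) by simp
    moreover have "card (A ` S) = card S"
      using A_bij flat_onD(1)[OF S(1)]
      by (intro card_image) (auto simp: bij_betw_def intro: inj_on_subset)
    ultimately have "A ` S = fst_axis m" "S = fst_axis m"
      using unique[of "A ` S"] unique[of S] S by simp_all
    then show False using assms(10) by (simp add: fst_axis_def)
  qed
qed

end
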